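(* Let $k\ge2$ be an integer. Then the set $\mathrm{Fix}(\mathcal{G}_k)=\{\alpha\in\mathbf{C}^2:\mathcal{G}_k(\alpha)=\alpha\}$ has exactly $k^2$ elements.
   Context: Define $\varPhi_{G_2}=(\varphi_1,\varphi_2):\mathbf{C}^2\to\mathbf{C}^2$ by $\varphi_1(\sigma,\tau)=e^{2\pi i\sigma}+e^{2\pi i\tau}+e^{2\pi i(\sigma+\tau)}+e^{-2\pi i\sigma}+e^{-2\pi i\tau}+e^{-2\pi i(\sigma+\tau)}$ and $\varphi_2(\sigma,\tau)=e^{2\pi i(2\sigma+\tau)}+e^{2\pi i(\sigma+2\tau)}+e^{2\pi i(\sigma-\tau)}+e^{-2\pi i(2\sigma+\tau)}+e^{-2\pi i(\sigma+2\tau)}+e^{-2\pi i(\sigma-\tau)}$. For each integer $k\ge0$, $\mathcal{G}_k:\mathbf{C}^2\to\mathbf{C}^2$ is the unique polynomial map (with integer coefficients) such that $\varPhi_{G_2}(k\sigma,k\tau)=\mathcal{G}_k(\varPhi_{G_2}(\sigma,\tau))$ for all $\sigma,\tau\in\mathbf{C}$. *)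

theory Defs
  imports Complex_Main
begin

definition expi :: "complex \<Rightarrow> complex" where
  "expi z = exp (2 * complex_of_real pi * \<i> * z)"

definition phi1 :: "complex \<Rightarrow> complex \<Rightarrow> complex" where
  "phi1 \<sigma> \<tau> = expi \<sigma> + expi \<tau> + expi (\<sigma> + \<tau>)
     + expi (- \<sigma>) + expi (- \<tau>) + expi (- (\<sigma> + \<tau>))"

definition phi2 :: "complex \<Rightarrow> complex \<Rightarrow> complex" where
  "phi2 \<sigma> \<tau> = expi (2 * \<sigma> + \<tau>) + expi (\<sigma> + 2 * \<tau>) + expi (\<sigma> - \<tau>)
     + expi (- (2 * \<sigma> + \<tau>)) + expi (- (\<sigma> + 2 * \<tau>)) + expi (- (\<sigma> - \<tau>))"

definition Phi_G2 :: "complex \<times> complex \<Rightarrow> complex \<times> complex" where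
  "Phi_G2 = (\<lambda>(\<sigma>, \<tau>). (phi1 \<sigma> \<tau>, phi2 \<sigma> \<tau>))"

definition int_poly_fun2 :: "(complex \<times> complex \<Rightarrow> complex) \<Rightarrow> bool" where
  "int_poly_fun2 p \<longleftrightarrow>
     (\<exists>(N::nat) (c :: nat \<Rightarrow> nat \<Rightarrow> int).
        \<forall>x y. p (x, y) = (\<Sum>i\<le>N. \<Sum>j\<le>N. of_int (c i j) * x ^ i * y ^ j))"

definition int_poly_map2 :: "(complex \<times> complex \<Rightarrow> complex \<times> complex) \<Rightarrow> bool" where
  "int_poly_map2 F \<longleftrightarrow> int_poly_fun2 (fst \<circ> F) \<and> int_poly_fun2 (snd \<circ> F)"

(* THE carries content: proving anything about G2_map k requires showing that such a
   polynomial map exists and is unique (as a function; over the complex numbers this is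
   the same as uniqueness of the coefficients). *)
definition G2_map :: "nat \<Rightarrow> complex \<times> complex \<Rightarrow> complex \<times> complex" where
  "G2_map k = (THE F. int_poly_map2 F \<and>
     (\<forall>\<sigma> \<tau>. Phi_G2 (of_nat k * \<sigma>, of_nat k * \<tau>) = F (Phi_G2 (\<sigma>, \<tau>))))"

definition Fix :: "('a \<Rightarrow> 'a) \<Rightarrow> 'a set" where
  "Fix F = {\<alpha>. F \<alpha> = \<alpha>}"

end

theory Submission
  imports Defs
    "HOL-Computational_Algebra.Fundamental_Theorem_Algebra"
    "HOL-Analysis.Complex_Transcendental"
begin

text \<open>With \<open>u = expi \<sigma>\<close>, \<open>v = expi \<tau>\<close> the map \<open>Phi_G2\<close> becomes the quotient of the torus by the Weyl
  group \<open>W\<close> of type \<open>G\<^sub>2\<close>, and \<open>G2_map k\<close> is induced by \<open>z \<mapsto> z\<^sup>k\<close>. So the fixed points are the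
  \<open>W\<close>-orbits of those \<open>z\<close> with \<open>z\<^sup>k = g z\<close> for some \<open>g \<in> W\<close>. Each such orbit contributes exactly
  \<open>|W| = 12\<close> pairs \<open>(g, z)\<close>, while for fixed \<open>g\<close> there are \<open>det (k - g)\<close> solutions \<open>z\<close>; and
  the sum of \<open>det (k - g)\<close> over \<open>W\<close> is \<open>12 k\<^sup>2\<close>.\<close>

section \<open>Integer polynomial functions\<close>

lemma int_poly_fun2_monom: "int_poly_fun2 (\<lambda>(x, y). of_int c * x ^ i * y ^ j)"
proof -
  have "of_int c * x ^ i * y ^ j
      = (\<Sum>i'\<le>max i j. \<Sum>j'\<le>max i j. of_int (if i' = i \<and> j' = j then c else 0) * x ^ i' * y ^ j')"
    for x y :: complex
  proof -
    have "(\<Sum>i'\<le>max i j. \<Sum>j'\<le>max i j. of_int (if i' = i \<and> j' = j then c else 0) * x ^ i' * y ^ j')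
        = (\<Sum>i'\<le>max i j. \<Sum>j'\<le>max i j. if j' = j then if i' = i then of_int c * x ^ i * y ^ j else 0 else 0)"
      by (intro sum.cong) auto
    also have "\<dots> = of_int c * x ^ i * y ^ j"
      by simp
    finally show ?thesis by simp
  qed
  then show ?thesis
    unfolding int_poly_fun2_def
    by (intro exI[of _ "max i j"] exI[of _ "\<lambda>i' j'. if i' = i \<and> j' = j then c else 0"]) simp
qed

text \<open>Raising the degree bound with zero coefficients lets two polynomials be added over a
  common index range.\<close>

lemma int_poly_fun2_pad:
  fixes x y :: complex and c :: "nat \<Rightarrow> nat \<Rightarrow> int"
  assumes "N \<le> M"
  shows "(\<Sum>i\<le>N. \<Sum>j\<le>N. of_int (c i j) * x ^ i * y ^ j)
    = (\<Sum>i\<le>M. \<Sum>j\<le>M. of_int (if i \<le> N \<and> j \<le> N then c i j else 0) * x ^ i * y ^ j)"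
proof -
  have "(\<Sum>i\<le>M. \<Sum>j\<le>M. of_int (if i \<le> N \<and> j \<le> N then c i j else 0) * x ^ i * y ^ j)
      = (\<Sum>i\<le>N. \<Sum>j\<le>M. of_int (if i \<le> N \<and> j \<le> N then c i j else 0) * x ^ i * y ^ j)"
    by (rule sum.mono_neutral_right) (use assms in auto)
  also have "\<dots> = (\<Sum>i\<le>N. \<Sum>j\<le>N. of_int (if i \<le> N \<and> j \<le> N then c i j else 0) * x ^ i * y ^ j)"
    by (intro sum.cong refl sum.mono_neutral_right) (use assms in auto)
  finally show ?thesis by simp
qed

lemma int_poly_fun2_add:
  assumes "int_poly_fun2 p" "int_poly_fun2 q"
  shows "int_poly_fun2 (\<lambda>z. p z + q z)"
proof -
  obtain N c where p: "\<And>x y. p (x, y) = (\<Sum>i\<le>N. \<Sum>j\<le>N. of_int (c i j) * x ^ i * y ^ j)"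
    using assms(1) unfolding int_poly_fun2_def by blast
  obtain M d where q: "\<And>x y. q (x, y) = (\<Sum>i\<le>M. \<Sum>j\<le>M. of_int (d i j) * x ^ i * y ^ j)"
    using assms(2) unfolding int_poly_fun2_def by blast
  define e where "e i j = (if i \<le> N \<and> j \<le> N then c i j else 0) + (if i \<le> M \<and> j \<le> M then d i j else 0)" for i j
  have "p (x, y) + q (x, y) = (\<Sum>i\<le>max N M. \<Sum>j\<le>max N M. of_int (e i j) * x ^ i * y ^ j)" for x y
    unfolding p q int_poly_fun2_pad[OF max.cobounded1[of N M]] int_poly_fun2_pad[OF max.cobounded2[of M N]]
      e_def of_int_add distrib_right sum.distrib ..
  then show ?thesis
    unfolding int_poly_fun2_def by blast
qed

lemma int_poly_fun2_const: "int_poly_fun2 (\<lambda>z. of_int c)"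
  using int_poly_fun2_monom[of c 0 0] by (simp add: case_prod_unfold)

lemma int_poly_fun2_fst: "int_poly_fun2 fst"
  using int_poly_fun2_monom[of 1 1 0] by (simp add: case_prod_unfold)

lemma int_poly_fun2_snd: "int_poly_fun2 snd"
  using int_poly_fun2_monom[of 1 0 1] by (simp add: case_prod_unfold)

lemma int_poly_fun2_sum:
  assumes "\<And>i. i \<in> A \<Longrightarrow> int_poly_fun2 (p i)"
  shows "int_poly_fun2 (\<lambda>z. \<Sum>i\<in>A. p i z)"
  using assms
proof (induction A rule: infinite_finite_induct)
  case (insert a A)
  then show ?case
    using int_poly_fun2_add[of "p a" "\<lambda>z. \<Sum>i\<in>A. p i z"] by simp
qed (use int_poly_fun2_const[of 0] in simp_all)

text \<open>Multiplying out gives a finite sum of monomials, and closure under sums does the rest;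
  no convolution of coefficients has to be formed.\<close>

lemma int_poly_fun2_mult:
  assumes "int_poly_fun2 p" "int_poly_fun2 q"
  shows "int_poly_fun2 (\<lambda>z. p z * q z)"
proof -
  obtain N c where p: "\<And>x y. p (x, y) = (\<Sum>i\<le>N. \<Sum>j\<le>N. of_int (c i j) * x ^ i * y ^ j)"
    using assms(1) unfolding int_poly_fun2_def by blast
  obtain M d where q: "\<And>x y. q (x, y) = (\<Sum>i\<le>M. \<Sum>j\<le>M. of_int (d i j) * x ^ i * y ^ j)"
    using assms(2) unfolding int_poly_fun2_def by blast
  have "p z * q z = (\<Sum>i\<le>N. \<Sum>j\<le>N. \<Sum>i'\<le>M. \<Sum>j'\<le>M.
      (case z of (x, y) \<Rightarrow> of_int (c i j * d i' j') * x ^ (i + i') * y ^ (j + j')))" for z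
  proof (cases z)
    case (Pair x y)
    have "p z * q z = (\<Sum>i\<le>N. \<Sum>j\<le>N. \<Sum>i'\<le>M. \<Sum>j'\<le>M.
        (of_int (c i j) * x ^ i * y ^ j) * (of_int (d i' j') * x ^ i' * y ^ j'))"
      unfolding Pair p q sum_distrib_right by (simp only: sum_distrib_left)
    then show ?thesis
      by (simp add: Pair power_add mult_ac)
  qed
  then have eq: "(\<lambda>z. p z * q z) = (\<lambda>z. \<Sum>i\<le>N. \<Sum>j\<le>N. \<Sum>i'\<le>M. \<Sum>j'\<le>M.
      (case z of (x, y) \<Rightarrow> of_int (c i j * d i' j') * x ^ (i + i') * y ^ (j + j')))"
    by (rule ext)
  show ?thesis
    unfolding eq by (intro int_poly_fun2_sum int_poly_fun2_monom)
qed

lemma int_poly_fun2_diff: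
  assumes "int_poly_fun2 p" "int_poly_fun2 q"
  shows "int_poly_fun2 (\<lambda>z. p z - q z)"
  using int_poly_fun2_add[OF assms(1) int_poly_fun2_mult[OF int_poly_fun2_const[of "-1"] assms(2)]]
  by simp

lemmas int_poly_fun2_intros =
  int_poly_fun2_const int_poly_fun2_fst int_poly_fun2_snd
  int_poly_fun2_add int_poly_fun2_diff int_poly_fun2_mult

section \<open>The torus and the quotient map\<close>

definition torus :: "(complex \<times> complex) set" where
  "torus = {(u, v). u \<noteq> 0 \<and> v \<noteq> 0}"

definition torus_pow :: "nat \<Rightarrow> complex \<times> complex \<Rightarrow> complex \<times> complex" where
  "torus_pow n = (\<lambda>(u, v). (u ^ n, v ^ n))"

text \<open>The elementary symmetric functions of the three numbers \<open>u\<close>, \<open>v\<close>, \<open>1 / (u v)\<close>, whose product is \<open>1\<close>.\<close>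

definition esym1 :: "complex \<times> complex \<Rightarrow> complex" where
  "esym1 = (\<lambda>(u, v). u + v + inverse (u * v))"

definition esym2 :: "complex \<times> complex \<Rightarrow> complex" where
  "esym2 = (\<lambda>(u, v). inverse u + inverse v + u * v)"

text \<open>The terms of \<open>phi1\<close> are the triple \<open>u\<close>, \<open>v\<close>,
  \<open>1 / (u v)\<close> and its inverses. Multiplying the two triples out gives the six terms of
  \<open>phi2\<close> and three products equal to 1, which the \<open>- 3\<close> removes.\<close>

definition G2_quot :: "complex \<times> complex \<Rightarrow> complex \<times> complex" where
  "G2_quot z = (esym1 z + esym2 z, esym1 z * esym2 z - 3)"

lemma torus_pow_closed: "z \<in> torus \<Longrightarrow> torus_pow n z \<in> torus"
  by (auto simp: torus_def torus_pow_def)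

lemma expi_nonzero: "expi z \<noteq> 0"
  by (simp add: expi_def)

lemma expi_add: "expi (x + y) = expi x * expi y"
  by (simp add: expi_def distrib_left exp_add)

lemma expi_minus: "expi (- x) = inverse (expi x)"
  by (simp add: expi_def exp_minus)

lemma expi_diff: "expi (x - y) = expi x * inverse (expi y)"
  using expi_add[of x "- y"] by (simp add: expi_minus)

lemma expi_of_nat_mult: "expi (of_nat n * x) = expi x ^ n"
  by (simp add: expi_def exp_of_nat_mult[symmetric] mult_ac)

lemma expi_surj:
  assumes "u \<noteq> 0"
  shows "\<exists>x. expi x = u"
  by (rule exI[of _ "Ln u / (2 * complex_of_real pi * \<i>)"]) (simp add: expi_def assms)

lemma Phi_G2_eq: "Phi_G2 (\<sigma>, \<tau>) = G2_quot (expi \<sigma>, expi \<tau>)"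
proof -
  have "expi (2 * x) = expi x * expi x" for x
    unfolding mult_2 by (rule expi_add)
  then show ?thesis
    using expi_nonzero[of \<sigma>] expi_nonzero[of \<tau>]
    unfolding Phi_G2_def phi1_def phi2_def G2_quot_def esym1_def esym2_def
      expi_minus expi_diff expi_add
    by (simp add: field_simps)
qed

lemma Phi_G2_of_nat_mult:
  "Phi_G2 (of_nat n * \<sigma>, of_nat n * \<tau>) = G2_quot (torus_pow n (expi \<sigma>, expi \<tau>))"
  by (simp add: Phi_G2_eq expi_of_nat_mult torus_pow_def)

section \<open>Surjectivity of the quotient map\<close>

lemma complex_quadratic_roots: "\<exists>s t :: complex. s + t = x \<and> s * t = y"
proof -
  define r where "r = csqrt (x\<^sup>2 / 4 - y)"
  have "r\<^sup>2 = x\<^sup>2 / 4 - y" by (simp add: r_def)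
  then have "(x / 2 + r) * (x / 2 - r) = y" 
    by (simp add: algebra_simps power2_eq_square)
  moreover have "(x / 2 + r) + (x / 2 - r) = x" by simp
  ultimately show ?thesis by blast
qed

lemma esym_surj: "\<exists>z\<in>torus. esym1 z = s \<and> esym2 z = t"
proof -
  \<comment> \<open>By Vieta the required triple consists of the roots of X^3 - s X^2 + t X - 1. One
    root \<open>u\<close> comes from the fundamental theorem of algebra; the other two have sum
    \<open>s - u\<close> and product \<open>1 / u\<close>.\<close>
  have "\<not> constant (poly [:- 1, t, - s, 1:])"
    by (simp add: constant_degree)
  then obtain u where "poly [:- 1, t, - s, 1:] u = 0"
    using fundamental_theorem_of_algebra by blast
  then have u: "u * (t + u * (u - s)) = 1"
    by (simp add: algebra_simps)
  then have "u \<noteq> 0" by auto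
  obtain v w where vw: "v + w = s - u" "v * w = inverse u"
    using complex_quadratic_roots by blast
  have "v \<noteq> 0" using vw \<open>u \<noteq> 0\<close> by auto
  have w: "w = inverse (u * v)"
    using vw(2) \<open>u \<noteq> 0\<close> \<open>v \<noteq> 0\<close> by (simp add: field_simps)
  have "esym1 (u, v) = s"
    using vw(1) unfolding esym1_def split_conv w[symmetric] by (simp add: algebra_simps)
  moreover have "esym2 (u, v) = t"
  proof -
    have "inverse v = u * w"
      using w \<open>u \<noteq> 0\<close> \<open>v \<noteq> 0\<close> by simp
    then have "inverse v + u * v = u * (s - u)"
      using vw(1) by (metis add.commute distrib_left)
    moreover have "inverse u = t + u * (u - s)"
      using u \<open>u \<noteq> 0\<close> by (simp add: field_simps)
    ultimately have "inverse u + (inverse v + u * v) = (t + u * (u - s)) + u * (s - u)"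
      by simp
    then show ?thesis
      unfolding esym2_def split_conv by (simp add: algebra_simps)
  qed
  ultimately show ?thesis
    using \<open>u \<noteq> 0\<close> \<open>v \<noteq> 0\<close> by (auto simp: torus_def)
qed

lemma G2_quot_surj: "\<exists>z\<in>torus. G2_quot z = \<alpha>"
proof -
  obtain s t where "s + t = fst \<alpha>" "s * t = snd \<alpha> + 3"
    using complex_quadratic_roots by blast
  moreover obtain z where "z \<in> torus" "esym1 z = s" "esym2 z = t"
    using esym_surj by blast
  ultimately show ?thesis
    by (intro bexI[of _ z]) (auto simp: G2_quot_def prod_eq_iff)
qed

section \<open>The maps \<open>G2_map k\<close>\<close>

lemma esym1_torus_pow: "esym1 (torus_pow n (u, v)) = u ^ n + v ^ n + inverse (u * v) ^ n"
  by (simp add: esym1_def torus_pow_def power_mult_distrib power_inverse)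

lemma esym2_torus_pow: "esym2 (torus_pow n (u, v)) = inverse u ^ n + inverse v ^ n + (u * v) ^ n"
  by (simp add: esym2_def torus_pow_def power_mult_distrib power_inverse)

text \<open>Each of \<open>x\<close>, \<open>y\<close>, \<open>z\<close> is a root of the monic
  cubic whose coefficients are their elementary symmetric functions. Multiplying that equation by
  the \<open>n\<close>-th power of the root and adding up the three cases gives Newton's
  recurrence.\<close>

lemma cubic_newton:
  fixes x y z :: "'a :: comm_ring_1"
  assumes "x * y * z = 1"
  shows "x ^ (n + 3) + y ^ (n + 3) + z ^ (n + 3)
    = (x + y + z) * (x ^ (n + 2) + y ^ (n + 2) + z ^ (n + 2))
      - (x * y + x * z + y * z) * (x ^ (n + 1) + y ^ (n + 1) + z ^ (n + 1))
      + (x ^ n + y ^ n + z ^ n)"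
proof -
  have "w ^ (n + 3) = (x + y + z) * w ^ (n + 2) - (x * y + x * z + y * z) * w ^ (n + 1) + w ^ n"
    if "(w - x) * (w - y) * (w - z) = 0" for w
  proof -
    have "w ^ (n + 3) - ((x + y + z) * w ^ (n + 2) - (x * y + x * z + y * z) * w ^ (n + 1) + (x * y * z) * w ^ n)
        = w ^ n * ((w - x) * (w - y) * (w - z))"
      by (simp add: power_add algebra_simps power2_eq_square power3_eq_cube)
    then show ?thesis
      unfolding that assms by simp
  qed
  from this[of x] this[of y] this[of z] show ?thesis
    by (simp add: ring_distribs)
qed

text \<open>Newton's recurrence is applied to \<open>u\<close>, \<open>v\<close>,
  \<open>1 / (u v)\<close> and to the inverse triple. As the product is 1, inversion exchanges the
  first two elementary symmetric functions.\<close>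

lemma esym_newton:
  assumes "z \<in> torus"
  shows "esym1 (torus_pow (n + 3) z) = esym1 z * esym1 (torus_pow (n + 2) z)
      - esym2 z * esym1 (torus_pow (n + 1) z) + esym1 (torus_pow n z)"
    and "esym2 (torus_pow (n + 3) z) = esym2 z * esym2 (torus_pow (n + 2) z)
      - esym1 z * esym2 (torus_pow (n + 1) z) + esym2 (torus_pow n z)"
proof -
  obtain u v where z: "z = (u, v)" "u \<noteq> 0" "v \<noteq> 0"
    using assms by (auto simp: torus_def)
  have "u * v + u * inverse (u * v) + v * inverse (u * v) = esym2 z"
    and "inverse u * inverse v + inverse u * (u * v) + inverse v * (u * v) = esym1 z"
    using z by (simp_all add: esym1_def esym2_def field_simps)
  moreover have "u * v * inverse (u * v) = 1" "inverse u * inverse v * (u * v) = 1"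
    using z by (simp_all add: field_simps)
  moreover have "u + v + inverse (u * v) = esym1 z" "inverse u + inverse v + u * v = esym2 z"
    using z by (simp_all add: esym1_def esym2_def)
  ultimately show "esym1 (torus_pow (n + 3) z) = esym1 z * esym1 (torus_pow (n + 2) z)
      - esym2 z * esym1 (torus_pow (n + 1) z) + esym1 (torus_pow n z)"
    and "esym2 (torus_pow (n + 3) z) = esym2 z * esym2 (torus_pow (n + 2) z)
      - esym1 z * esym2 (torus_pow (n + 1) z) + esym2 (torus_pow n z)"
    using cubic_newton[of u v "inverse (u * v)" n] cubic_newton[of "inverse u" "inverse v" "u * v" n]
    by (simp_all only: esym1_torus_pow esym2_torus_pow z(1))
qed

text \<open>\<open>esym1\<close> and \<open>esym2\<close> are conjugate roots of a monic quadratic polynomial over the ring of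
  integer polynomials in \<open>G2_quot\<close>, so \<open>a + b * esym1\<close> has conjugate \<open>a + b * esym2\<close>, and trace and
  norm of such an element lie in that ring.\<close>

lemma esym_torus_pow_poly:
  "\<exists>a b. int_poly_fun2 a \<and> int_poly_fun2 b \<and> (\<forall>z\<in>torus.
     esym1 (torus_pow n z) = a (G2_quot z) + b (G2_quot z) * esym1 z \<and>
     esym2 (torus_pow n z) = a (G2_quot z) + b (G2_quot z) * esym2 z)"
proof (induction n rule: less_induct)
  case (less n)
  consider "n = 0" | "n = 1" | "n = 2" | m where "n = m + 3"
  proof -
    have "n = 0 \<or> n = 1 \<or> n = 2 \<or> n = (n - 3) + 3" by arith
    then show ?thesis using that by blast
  qed
  then show ?case
  proof cases
    case 1
    have "int_poly_fun2 (\<lambda>z. 3)" "int_poly_fun2 (\<lambda>z. 0)"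
      using int_poly_fun2_const[of 3] int_poly_fun2_const[of 0] by simp_all
    moreover have "\<forall>z\<in>torus. esym1 (torus_pow 0 z) = 3 \<and> esym2 (torus_pow 0 z) = 3"
      by (auto simp: esym1_torus_pow esym2_torus_pow torus_def)
    ultimately show ?thesis
      using 1 by (intro exI[of _ "\<lambda>z. 3"] exI[of _ "\<lambda>z. 0"]) auto
  next
    case 2
    have "int_poly_fun2 (\<lambda>z. 0)" "int_poly_fun2 (\<lambda>z. 1)"
      using int_poly_fun2_const[of 0] int_poly_fun2_const[of 1] by simp_all
    then show ?thesis
      using 2 by (intro exI[of _ "\<lambda>z. 0"] exI[of _ "\<lambda>z. 1"]) (auto simp: torus_pow_def)
  next
    case 3
    \<comment> \<open>Write s, t for \<open>esym1 z\<close>, \<open>esym2 z\<close> and (x, y) for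
      \<open>G2_quot z\<close>. Reducing s^2 - 2 t by t = x - s and s^2 = x s - (y + 3) gives these
      coefficients.\<close>
    define a where "a = (\<lambda>z :: complex \<times> complex. of_int (- 3) - snd z - of_int 2 * fst z)"
    define b where "b = (\<lambda>z :: complex \<times> complex. fst z + of_int 2)"
    have "int_poly_fun2 a" "int_poly_fun2 b"
      unfolding a_def b_def by (intro int_poly_fun2_intros)+
    moreover have "esym1 (torus_pow 2 z) = a (G2_quot z) + b (G2_quot z) * esym1 z \<and>
        esym2 (torus_pow 2 z) = a (G2_quot z) + b (G2_quot z) * esym2 z" if "z \<in> torus" for z
    proof -
      have "esym1 (torus_pow 2 z) = esym1 z ^ 2 - 2 * esym2 z"
        "esym2 (torus_pow 2 z) = esym2 z ^ 2 - 2 * esym1 z"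
        using that by (auto simp: torus_def torus_pow_def esym1_def esym2_def
            field_simps power2_eq_square)
      then show ?thesis
        by (simp add: a_def b_def G2_quot_def algebra_simps power2_eq_square)
    qed
    ultimately show ?thesis
      using 3 by blast
  next
    case (4 m)
    obtain a0 b0 where 0: "int_poly_fun2 a0" "int_poly_fun2 b0" "\<And>z. z \<in> torus \<Longrightarrow>
       esym1 (torus_pow m z) = a0 (G2_quot z) + b0 (G2_quot z) * esym1 z \<and>
       esym2 (torus_pow m z) = a0 (G2_quot z) + b0 (G2_quot z) * esym2 z"
      using less[of m] 4 by auto
    obtain a1 b1 where 1: "int_poly_fun2 a1" "int_poly_fun2 b1" "\<And>z. z \<in> torus \<Longrightarrow>
       esym1 (torus_pow (m + 1) z) = a1 (G2_quot z) + b1 (G2_quot z) * esym1 z \<and>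
       esym2 (torus_pow (m + 1) z) = a1 (G2_quot z) + b1 (G2_quot z) * esym2 z"
      using less[of "m + 1"] 4 by auto
    obtain a2 b2 where 2: "int_poly_fun2 a2" "int_poly_fun2 b2" "\<And>z. z \<in> torus \<Longrightarrow>
       esym1 (torus_pow (m + 2) z) = a2 (G2_quot z) + b2 (G2_quot z) * esym1 z \<and>
       esym2 (torus_pow (m + 2) z) = a2 (G2_quot z) + b2 (G2_quot z) * esym2 z"
      using less[of "m + 2"] 4 by auto
    \<comment> \<open>With s, t, x, y as in the case of exponent 2, these coefficients result from
      reducing Newton's recurrence by t = x - s, s t = y + 3 and s^2 = x s - (y + 3).\<close>
    define a where "a = (\<lambda>z. a0 z - (a1 z * fst z + b1 z * (snd z + of_int 3)) - b2 z * (snd z + of_int 3))"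
    define b where "b = (\<lambda>z. b0 z + a1 z + a2 z + b2 z * fst z)"
    have "int_poly_fun2 a" "int_poly_fun2 b"
      unfolding a_def b_def by (intro int_poly_fun2_intros 0 1 2)+
    moreover have "esym1 (torus_pow n z) = a (G2_quot z) + b (G2_quot z) * esym1 z \<and>
        esym2 (torus_pow n z) = a (G2_quot z) + b (G2_quot z) * esym2 z" if "z \<in> torus" for z
      unfolding 4 esym_newton[OF that] conjunct1[OF 0(3)[OF that]] conjunct2[OF 0(3)[OF that]]
        conjunct1[OF 1(3)[OF that]] conjunct2[OF 1(3)[OF that]]
        conjunct1[OF 2(3)[OF that]] conjunct2[OF 2(3)[OF that]]
      by (simp add: a_def b_def G2_quot_def algebra_simps)
    ultimately show ?thesis
      by blast
  qed
qed

lemma G2_map_exists: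
  "\<exists>F. int_poly_map2 F \<and> (\<forall>z\<in>torus. G2_quot (torus_pow n z) = F (G2_quot z))"
proof -
  obtain a b where a: "int_poly_fun2 a" and b: "int_poly_fun2 b" and ab: "\<And>z. z \<in> torus \<Longrightarrow>
     esym1 (torus_pow n z) = a (G2_quot z) + b (G2_quot z) * esym1 z \<and>
     esym2 (torus_pow n z) = a (G2_quot z) + b (G2_quot z) * esym2 z"
    using esym_torus_pow_poly[of n] by blast
  \<comment> \<open>The components are the trace of a + b s and its norm minus 3, expressed through
    s + t = x and s t = y + 3.\<close>
  define F where "F = (\<lambda>z. (of_int 2 * a z + b z * fst z,
    a z * a z + a z * b z * fst z + b z * b z * (snd z + of_int 3) - of_int 3))"
  have "int_poly_map2 F"
    unfolding int_poly_map2_def F_def o_def fst_conv snd_conv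
    by (intro conjI int_poly_fun2_intros a b)
  moreover have "G2_quot (torus_pow n z) = F (G2_quot z)" if "z \<in> torus" for z
    using ab[OF that] by (simp add: F_def G2_quot_def algebra_simps)
  ultimately show ?thesis by blast
qed

text \<open>Since \<open>expi\<close> maps onto the nonzero numbers, the functional equation
  defining \<open>G2_map n\<close> is an identity on the torus. Surjectivity of
  \<open>G2_quot\<close> then determines every value of \<open>F\<close>, so the definite
  description denotes.\<close>

lemma G2_map_quot:
  assumes "z \<in> torus"
  shows "G2_map n (G2_quot z) = G2_quot (torus_pow n z)"
proof -
  have iff: "(\<forall>\<sigma> \<tau>. Phi_G2 (of_nat n * \<sigma>, of_nat n * \<tau>) = F (Phi_G2 (\<sigma>, \<tau>)))
      \<longleftrightarrow> (\<forall>z\<in>torus. G2_quot (torus_pow n z) = F (G2_quot z))" (is "?L \<longleftrightarrow> ?R") for F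
  proof
    assume L: ?L
    show ?R
    proof
      fix z assume "z \<in> torus"
      then obtain \<sigma> \<tau> where "z = (expi \<sigma>, expi \<tau>)"
        using expi_surj[of "fst z"] expi_surj[of "snd z"] by (cases z) (auto simp: torus_def)
      then show "G2_quot (torus_pow n z) = F (G2_quot z)"
        using L[rule_format, of \<sigma> \<tau>, unfolded Phi_G2_of_nat_mult, unfolded Phi_G2_eq] by simp
    qed
  next
    assume R: ?R
    have "(expi \<sigma>, expi \<tau>) \<in> torus" for \<sigma> \<tau>
      by (simp add: torus_def expi_nonzero)
    then show ?L
      using R unfolding Phi_G2_of_nat_mult by (simp add: Phi_G2_eq)
  qed
  have "\<exists>!F. int_poly_map2 F \<and> (\<forall>z\<in>torus. G2_quot (torus_pow n z) = F (G2_quot z))"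
  proof (rule ex_ex1I[OF G2_map_exists])
    fix F F'
    assume F: "int_poly_map2 F \<and> (\<forall>z\<in>torus. G2_quot (torus_pow n z) = F (G2_quot z))"
      and F': "int_poly_map2 F' \<and> (\<forall>z\<in>torus. G2_quot (torus_pow n z) = F' (G2_quot z))"
    show "F = F'"
    proof
      fix \<alpha>
      obtain z where z: "z \<in> torus" "G2_quot z = \<alpha>"
        using G2_quot_surj by blast
      have "G2_quot (torus_pow n z) = F \<alpha>"
        using conjunct2[OF F] z by simp
      moreover have "G2_quot (torus_pow n z) = F' \<alpha>"
        using conjunct2[OF F'] z by simp
      ultimately show "F \<alpha> = F' \<alpha>" by simp
    qed
  qed
  then have "\<forall>z\<in>torus. G2_quot (torus_pow n z) = G2_map n (G2_quot z)"
    unfolding G2_map_def iff by (rule theI'[THEN conjunct2])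
  then show ?thesis
    using assms by simp
qed

section \<open>The Weyl group\<close>

text \<open>A quadruple \<open>(a, b, c, d)\<close> stands for the matrix with rows \<open>(a, b)\<close> and \<open>(c, d)\<close>, which acts
  on exponents.\<close>

definition mat2_mult :: "int \<times> int \<times> int \<times> int \<Rightarrow> int \<times> int \<times> int \<times> int \<Rightarrow> int \<times> int \<times> int \<times> int" where
  "mat2_mult = (\<lambda>(a, b, c, d) (a', b', c', d').
     (a * a' + b * c', a * b' + b * d', c * a' + d * c', c * b' + d * d'))"

definition torus_act :: "int \<times> int \<times> int \<times> int \<Rightarrow> complex \<times> complex \<Rightarrow> complex \<times> complex" where
  "torus_act = (\<lambda>(a, b, c, d) (u, v). (u powi a * v powi b, u powi c * v powi d))"

text \<open>The first six matrices permute \<open>u\<close>, \<open>v\<close>,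
  \<open>1 / (u v)\<close>; the last six are their negatives, which also invert.\<close>

definition G2_weyl :: "(int \<times> int \<times> int \<times> int) set" where
  "G2_weyl = {(1, 0, 0, 1), (0, 1, 1, 0), (-1, -1, 0, 1), (1, 0, -1, -1), (0, 1, -1, -1), (-1, -1, 1, 0),
     (-1, 0, 0, -1), (0, -1, -1, 0), (1, 1, 0, -1), (-1, 0, 1, 1), (0, -1, 1, 1), (1, 1, -1, 0)}"

lemma finite_G2_weyl: "finite G2_weyl"
  by (simp add: G2_weyl_def)

lemma card_G2_weyl: "card G2_weyl = 12"
  by (simp add: G2_weyl_def)

lemma mat2_mult_assoc: "mat2_mult (mat2_mult f g) h = mat2_mult f (mat2_mult g h)"
  by (simp add: mat2_mult_def algebra_simps split: prod.splits)

lemma mat2_mult_one: "mat2_mult (1, 0, 0, 1) g = g" "mat2_mult g (1, 0, 0, 1) = g"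
  by (simp_all add: mat2_mult_def split: prod.splits)

lemma mat2_mult_closed: "g \<in> G2_weyl \<Longrightarrow> h \<in> G2_weyl \<Longrightarrow> mat2_mult g h \<in> G2_weyl"
proof -
  have "\<forall>g\<in>G2_weyl. \<forall>h\<in>G2_weyl. mat2_mult g h \<in> G2_weyl"
    by (simp add: G2_weyl_def mat2_mult_def)
  then show "g \<in> G2_weyl \<Longrightarrow> h \<in> G2_weyl \<Longrightarrow> mat2_mult g h \<in> G2_weyl" by blast
qed

lemma mat2_mult_inverse:
  assumes "g \<in> G2_weyl"
  shows "\<exists>h. mat2_mult h g = (1, 0, 0, 1) \<and> mat2_mult g h = (1, 0, 0, 1)"
proof -
  obtain a b c d where g: "g = (a, b, c, d)" by (cases g)
  define e where "e = a * d - b * c"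
  have "e = 1 \<or> e = - 1"
    using assms by (auto simp: G2_weyl_def g e_def)
  then have "e * e = 1" by auto
  then show ?thesis
    unfolding g mat2_mult_def
    \<comment> \<open>The determinant \<open>e\<close> is its own inverse, so \<open>e\<close> times
      the adjugate inverts \<open>g\<close>.\<close>
    by (intro exI[of _ "(e * d, - e * b, - e * c, e * a)"]) (simp add: e_def algebra_simps)
qed

lemma inj_mat2_mult:
  assumes "g \<in> G2_weyl"
  shows "inj (mat2_mult g)" "inj (\<lambda>h. mat2_mult h g)"
proof -
  obtain g' where g': "mat2_mult g' g = (1, 0, 0, 1)" "mat2_mult g g' = (1, 0, 0, 1)"
    using mat2_mult_inverse[OF assms] by blast
  show "inj (mat2_mult g)"
    by (rule inj_on_inverseI[of _ "mat2_mult g'"]) (simp add: g' mat2_mult_one flip: mat2_mult_assoc)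
  show "inj (\<lambda>h. mat2_mult h g)"
    by (rule inj_on_inverseI[of _ "\<lambda>h. mat2_mult h g'"]) (simp add: g' mat2_mult_one mat2_mult_assoc)
qed

lemma torus_act_mult:
  assumes "z \<in> torus"
  shows "torus_act (mat2_mult g h) z = torus_act g (torus_act h z)"
proof -
  obtain u v where z: "z = (u, v)" "u \<noteq> 0" "v \<noteq> 0"
    using assms by (auto simp: torus_def)
  obtain a b c d where g: "g = (a, b, c, d)" by (cases g)
  obtain a' b' c' d' where h: "h = (a', b', c', d')" by (cases h)
  have eq: "u powi (a * a' + b * c') * v powi (a * b' + b * d')
      = (u powi a' * v powi b') powi a * (u powi c' * v powi d') powi b" for a b
    using z(2,3)
    by (simp add: power_int_add power_int_mult_distrib power_int_mult[symmetric] mult_ac)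
  show ?thesis
    by (simp add: z(1) g h mat2_mult_def torus_act_def eq)
qed

lemma torus_act_closed: "z \<in> torus \<Longrightarrow> torus_act g z \<in> torus"
  by (auto simp: torus_def torus_act_def split: prod.splits)

section \<open>Fibres of the quotient map as Weyl group orbits\<close>

lemma G2_quot_act:
  assumes "z \<in> torus" "g \<in> G2_weyl"
  shows "G2_quot (torus_act g z) = G2_quot z"
proof -
  obtain u v where z: "z = (u, v)" "u \<noteq> 0" "v \<noteq> 0"
    using assms by (auto simp: torus_def)
  \<comment> \<open>Permutations keep \<open>esym1\<close> and \<open>esym2\<close>, their negatives
    exchange them, and \<open>G2_quot\<close> is symmetric in the two.\<close>
  have "esym1 (torus_act g z) = esym1 z \<and> esym2 (torus_act g z) = esym2 z
      \<or> esym1 (torus_act g z) = esym2 z \<and> esym2 (torus_act g z) = esym1 z"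
    using assms(2) z(2,3) unfolding G2_weyl_def
    by (auto simp: z(1) torus_act_def esym1_def esym2_def)
  then show ?thesis
    by (auto simp: G2_quot_def add.commute mult.commute)
qed

lemma sum_prod_eq_cases:
  fixes v w :: "'a :: idom"
  assumes "v + w = v' + w'" "v * w = v' * w'"
  shows "v' = v \<or> v' = w"
proof -
  have "(v' - v) * (v' - w) = v' * v' - (v + w) * v' + v * w"
    by (simp add: algebra_simps)
  also have "\<dots> = 0"
    unfolding assms by (simp add: algebra_simps)
  finally show ?thesis by simp
qed

text \<open>Both triples have product 1 and agree in the other elementary symmetric functions, so
  they are the roots of one cubic and differ by one of six permutations.\<close>

lemma esym_eq_imp_act:
  assumes z: "z \<in> torus" and z': "z' \<in> torus"
    and eq: "esym1 z' = esym1 z" "esym2 z' = esym2 z"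
  shows "\<exists>g\<in>{(1, 0, 0, 1), (0, 1, 1, 0), (-1, -1, 0, 1), (1, 0, -1, -1), (0, 1, -1, -1), (-1, -1, 1, 0)}.
    torus_act g z = z'"
proof -
  obtain u v where uv: "z = (u, v)" "u \<noteq> 0" "v \<noteq> 0"
    using z by (auto simp: torus_def)
  obtain u' v' where uv': "z' = (u', v')" "u' \<noteq> 0" "v' \<noteq> 0"
    using z' by (auto simp: torus_def)
  define w w' where "w = inverse (u * v)" and "w' = inverse (u' * v')"
  have w: "u * v * w = 1" and w': "u' * v' * w' = 1"
    using uv uv' by (simp_all add: w_def w'_def field_simps)
  have s: "u' + v' + w' = u + v + w"
    using eq(1) by (simp add: uv uv' esym1_def w_def w'_def)
  have t: "u' * v' + u' * w' + v' * w' = u * v + u * w + v * w"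
    using eq(2) uv uv' by (simp add: esym2_def w_def w'_def field_simps)
  have "(u' - u) * (u' - v) * (u' - w)
      = u' ^ 3 - (u + v + w) * u' ^ 2 + (u * v + u * w + v * w) * u' - u * v * w"
    by (simp add: algebra_simps power2_eq_square power3_eq_cube)
  also have "\<dots> = 0"
    unfolding s[symmetric] t[symmetric] w w'[symmetric]
    by (simp add: algebra_simps power2_eq_square power3_eq_cube)
  finally have "u' = u \<or> u' = v \<or> u' = w"
    by simp
  \<comment> \<open>Once \<open>u'\<close> is matched with \<open>a\<close>, cancelling it leaves
    two pairs with equal sum and product.\<close>
  moreover have "v' = b \<or> v' = c" if "u' = a" "a + b + c = u + v + w" "a * b * c = 1" for a b c
  proof (rule sum_prod_eq_cases[of b c v' w'])
    have "a + (b + c) = a + (v' + w')"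
      using that s by (simp add: add.assoc)
    then show "b + c = v' + w'"
      by simp
    have "u' * (b * c) = u' * (v' * w')"
      using that w' by (simp add: mult_ac)
    then show "b * c = v' * w'"
      using uv' by simp
  qed
  note this[of u v w] this[of v u w] this[of w u v]
  ultimately have "(u', v') \<in> {(u, v), (v, u), (w, v), (u, w), (v, w), (w, u)}"
    using w by (auto simp: algebra_simps)
  then show ?thesis
    by (auto simp: uv(1) uv'(1) torus_act_def w_def)
qed

text \<open>Equal sum and product match the values of \<open>esym1\<close> and \<open>esym2\<close>
  up to an exchange, and an exchange is undone by minus the identity.\<close>

lemma G2_quot_eq_imp_act:
  assumes z: "z \<in> torus" and z': "z' \<in> torus" and eq: "G2_quot z = G2_quot z'"
  shows "\<exists>g\<in>G2_weyl. torus_act g z = z'"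
proof -
  have "esym1 z' = esym1 z \<or> esym1 z' = esym2 z"
    using eq by (intro sum_prod_eq_cases[of _ _ _ "esym2 z'"]) (simp_all add: G2_quot_def)
  then show ?thesis
  proof
    assume "esym1 z' = esym1 z"
    moreover from this have "esym2 z' = esym2 z"
      using eq by (simp add: G2_quot_def)
    ultimately show ?thesis
      using esym_eq_imp_act[OF z z'] unfolding G2_weyl_def by blast
  next
    define z'' where "z'' = torus_act (-1, 0, 0, -1) z'"
    have z'': "z'' \<in> torus"
      using z' by (simp add: z''_def torus_act_closed)
    have z'_eq: "z' = torus_act (-1, 0, 0, -1) z''"
      by (simp add: z''_def torus_act_def split: prod.splits)
    assume *: "esym1 z' = esym2 z"
    then have "esym2 z' = esym1 z"
      using eq by (simp add: G2_quot_def)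
    with * have "esym1 z'' = esym1 z" "esym2 z'' = esym2 z"
      by (auto simp: z''_def torus_act_def esym1_def esym2_def split: prod.splits)
    then obtain g where g: "g \<in> G2_weyl" "torus_act g z = z''"
      using esym_eq_imp_act[OF z z''] unfolding G2_weyl_def by blast
    have "(-1, 0, 0, -1) \<in> G2_weyl"
      by (simp add: G2_weyl_def)
    then have "mat2_mult (-1, 0, 0, -1) g \<in> G2_weyl"
      using g(1) by (rule mat2_mult_closed)
    moreover have "torus_act (mat2_mult (-1, 0, 0, -1) g) z = z'"
      unfolding torus_act_mult[OF z] g(2) z'_eq ..
    ultimately show ?thesis by blast
  qed
qed

section \<open>Counting\<close>

text \<open>In a transitive action the number \<open>N x y\<close> of group elements taking \<open>x\<close> to \<open>y\<close> does not depend
  on \<open>x\<close> and \<open>y\<close>, so summing over the graph of any self-map gives the same as summing \<open>N x\<close> over the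
  whole orbit.\<close>

lemma card_transitive_act_eq_self_map:
  fixes act :: "'g \<Rightarrow> 'a \<Rightarrow> 'a" and mul :: "'g \<Rightarrow> 'g \<Rightarrow> 'g"
  assumes fin: "finite W" and "x0 \<in> X"
    and mul_closed: "\<And>g h. g \<in> W \<Longrightarrow> h \<in> W \<Longrightarrow> mul g h \<in> W"
    and mul_inj: "\<And>g. g \<in> W \<Longrightarrow> inj (mul g)" "\<And>g. g \<in> W \<Longrightarrow> inj (\<lambda>h. mul h g)"
    and act_mul: "\<And>g h x. g \<in> W \<Longrightarrow> h \<in> W \<Longrightarrow> x \<in> X \<Longrightarrow> act (mul g h) x = act g (act h x)"
    and act_closed: "\<And>g x. g \<in> W \<Longrightarrow> x \<in> X \<Longrightarrow> act g x \<in> X"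
    and trans: "\<And>x y. x \<in> X \<Longrightarrow> y \<in> X \<Longrightarrow> \<exists>g\<in>W. act g x = y"
    and f: "\<And>x. x \<in> X \<Longrightarrow> f x \<in> X"
  shows "card {(g, x). g \<in> W \<and> x \<in> X \<and> f x = act g x} = card W"
proof -
  define N where "N x y = card {g \<in> W. y = act g x}" for x y
  have "X \<subseteq> (\<lambda>g. act g x0) ` W"
    using trans[OF \<open>x0 \<in> X\<close>] by fast
  then have "finite X"
    using fin finite_surj by blast
  \<comment> \<open>Left multiplication by an element taking \<open>y\<close> to \<open>y'\<close>
    turns elements taking \<open>x\<close> to \<open>y\<close> into elements taking \<open>x\<close>
    to \<open>y'\<close>.\<close>
  have right: "N x y \<le> N x y'" if "x \<in> X" "y \<in> X" "y' \<in> X" for x y y'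
  proof -
    from trans[OF that(2,3)] obtain g where g: "g \<in> W" "act g y = y'"
      by blast
    show ?thesis
      unfolding N_def
    proof (rule card_inj_on_le[of "mul g"])
      show "inj_on (mul g) {h \<in> W. y = act h x}"
        using mul_inj(1)[OF g(1)] by (rule inj_on_subset) simp
      show "mul g ` {h \<in> W. y = act h x} \<subseteq> {h \<in> W. y' = act h x}"
        using g that by (auto simp: act_mul mul_closed)
    qed (use fin in simp)
  qed
  \<comment> \<open>Right multiplication by an element taking \<open>x\<close> to \<open>x'\<close>
    turns elements taking \<open>x'\<close> to \<open>y\<close> into elements taking
    \<open>x\<close> to \<open>y\<close>.\<close>
  have left: "N x' y \<le> N x y" if "x \<in> X" "x' \<in> X" "y \<in> X" for x x' y
  proof -
    from trans[OF that(1,2)] obtain g where g: "g \<in> W" "act g x = x'"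
      by blast
    show ?thesis
      unfolding N_def
    proof (rule card_inj_on_le[of "\<lambda>h. mul h g"])
      show "inj_on (\<lambda>h. mul h g) {h \<in> W. y = act h x'}"
        using mul_inj(2)[OF g(1)] by (rule inj_on_subset) simp
      show "(\<lambda>h. mul h g) ` {h \<in> W. y = act h x'} \<subseteq> {h \<in> W. y = act h x}"
        using g that by (auto simp: act_mul mul_closed)
    qed (use fin in simp)
  qed
  have N_const: "N x y = N x0 x0" if "x \<in> X" "y \<in> X" for x y
    using right[of x y x0] right[of x x0 y] left[of x x0 x0] left[of x0 x x0] that \<open>x0 \<in> X\<close> by simp
  have "card {(g, x). g \<in> W \<and> x \<in> X \<and> f x = act g x} = card (SIGMA x:X. {g \<in> W. f x = act g x})"
    by (rule bij_betw_same_card[of prod.swap]) (auto simp: bij_betw_def image_def)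
  also have "\<dots> = (\<Sum>x\<in>X. N x (f x))"
    unfolding N_def using \<open>finite X\<close> fin by simp
  also have "\<dots> = (\<Sum>x\<in>X. N x0 x)"
  proof (rule sum.cong[OF refl])
    show "N x (f x) = N x0 x" if "x \<in> X" for x
      using N_const[OF that f[OF that]] N_const[OF \<open>x0 \<in> X\<close> that] by (simp only:)
  qed
  \<comment> \<open>Each element of \<open>W\<close> takes \<open>x0\<close> to exactly one point of
    \<open>X\<close>, so these sets partition \<open>W\<close>.\<close>
  also have "\<dots> = card (\<Union>x\<in>X. {g \<in> W. x = act g x0})"
    unfolding N_def using \<open>finite X\<close> fin by (subst card_UN_disjoint) auto
  also have "(\<Union>x\<in>X. {g \<in> W. x = act g x0}) = W"
    using act_closed \<open>x0 \<in> X\<close> by auto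
  finally show ?thesis .
qed

section \<open>Solutions on the torus for a fixed Weyl group element\<close>

lemma card_powi_roots_unity:
  assumes "n > 0"
  shows "card {z :: complex. z \<noteq> 0 \<and> z powi n = 1} = nat n"
proof -
  have "{z :: complex. z \<noteq> 0 \<and> z powi n = 1} = {z. z ^ nat n = 1}"
    using assms by (auto simp: power_int_def power_0_left)
  then show ?thesis
    using assms card_roots_unity_eq[of "nat n"] by simp
qed

lemma powi_eq_iff:
  fixes u :: "'a :: field"
  assumes "u \<noteq> 0"
  shows "u powi m = u powi n \<longleftrightarrow> u powi (m - n) = 1"
  using assms by (simp add: power_int_diff)

definition act_solutions :: "nat \<Rightarrow> int \<times> int \<times> int \<times> int \<Rightarrow> (complex \<times> complex) set" where
  "act_solutions k g = {z \<in> torus. torus_pow k z = torus_act g z}"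

text \<open>If an off-diagonal entry of the matrix \<open>g\<close> is a unit, one coordinate of a solution is a monomial
  in the other one, which is a root of unity of order dividing \<open>det (k - g)\<close>.\<close>

lemma card_act_solutions:
  assumes b: "b = 1 \<or> b = - 1" and D: "D = (int k - a) * (int k - d) - b * c" "D > 0"
  shows "card (act_solutions k (a, b, c, d)) = nat D"
proof -
  have bb: "b * b = 1" using b by auto
  \<comment> \<open>As \<open>b\<close> is its own inverse, the first equation solved for
    \<open>v\<close> reads \<open>v = u powi ?e\<close>.\<close>
  let ?e = "b * (int k - a)"
  have "act_solutions k (a, b, c, d) = (\<lambda>u. (u, u powi ?e)) ` {u. u \<noteq> 0 \<and> u powi D = 1}"
    (is "_ = ?f ` _")
  proof -
    have iff: "u ^ k = u powi a * v powi b \<and> v ^ k = u powi c * v powi d \<longleftrightarrow> v = u powi ?e \<and> u powi D = 1"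
      if "u \<noteq> 0" "v \<noteq> 0" for u v :: complex
    proof -
      have "u ^ k = u powi a * v powi b \<longleftrightarrow> v powi b = u powi (int k - a)"
        using that by (auto simp: power_int_diff field_simps)
      also have "\<dots> \<longleftrightarrow> v = u powi ?e"
        using b that by (auto simp: power_int_minus power_int_diff field_simps)
      finally have 1: "u ^ k = u powi a * v powi b \<longleftrightarrow> v = u powi ?e" .
      have "v ^ k = u powi c * v powi d \<longleftrightarrow> u powi D = 1" if v: "v = u powi ?e"
      proof -
        have "v ^ k = u powi c * v powi d \<longleftrightarrow> u powi (?e * int k) = u powi (c + ?e * d)"
          using \<open>u \<noteq> 0\<close> by (simp add: v power_int_add power_int_mult)
        also have "\<dots> \<longleftrightarrow> u powi (b * D) = 1"
        proof -
          \<comment> \<open>After substitution the two exponents of \<open>u\<close> differ by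
            \<open>b * D\<close>; the sign \<open>b\<close> does not affect whether the power is
            1.\<close>
          have "b * D = ?e * int k - ((b * b) * c + ?e * d)"
            unfolding D(1) by (simp add: algebra_simps)
          then show ?thesis
            using powi_eq_iff[OF \<open>u \<noteq> 0\<close>] by (simp add: bb)
        qed
        also have "\<dots> \<longleftrightarrow> u powi D = 1"
          using b by (auto simp: power_int_minus)
        finally show ?thesis .
      qed
      with 1 show ?thesis by blast
    qed
    have "act_solutions k (a, b, c, d)
        = {(u, v). u \<noteq> 0 \<and> v \<noteq> 0 \<and> u ^ k = u powi a * v powi b \<and> v ^ k = u powi c * v powi d}"
      by (auto simp: act_solutions_def torus_def torus_pow_def torus_act_def)
    also have "\<dots> = {(u, v). u \<noteq> 0 \<and> v \<noteq> 0 \<and> v = u powi ?e \<and> u powi D = 1}"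
      using iff by blast
    also have "\<dots> = ?f ` {u. u \<noteq> 0 \<and> u powi D = 1}"
      by auto
    finally show ?thesis .
  qed
  moreover have "inj_on ?f A" for A
    by (auto intro: inj_onI)
  ultimately show ?thesis
    by (simp add: card_image card_powi_roots_unity[OF D(2)])
qed

text \<open>Exchanging the coordinates moves \<open>c\<close> to the upper right corner, where it
  can serve as the unit in \<open>card_act_solutions\<close>.\<close>

lemma card_act_solutions_swap:
  "card (act_solutions k (a, b, c, d)) = card (act_solutions k (d, c, b, a))"
proof (rule bij_betw_same_card[of prod.swap])
  have "act_solutions k (d, c, b, a) = prod.swap ` act_solutions k (a, b, c, d)"
    by (force simp: act_solutions_def torus_def torus_pow_def torus_act_def image_iff mult.commute)
  then show "bij_betw prod.swap (act_solutions k (a, b, c, d)) (act_solutions k (d, c, b, a))"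
    by (simp add: bij_betw_def)
qed

lemma card_act_solutions_scalar:
  assumes "int k > a"
  shows "card (act_solutions k (a, 0, 0, a)) = nat (int k - a) ^ 2"
proof -
  have "u ^ k = u powi a \<longleftrightarrow> u powi (int k - a) = 1" if "u \<noteq> 0" for u :: complex
    using powi_eq_iff[OF that, of "int k" a] by simp
  then have "act_solutions k (a, 0, 0, a)
      = {u. u \<noteq> 0 \<and> u powi (int k - a) = 1} \<times> {u. u \<noteq> 0 \<and> u powi (int k - a) = 1}"
    by (auto simp: act_solutions_def torus_def torus_pow_def torus_act_def)
  then show ?thesis
    using assms by (simp add: card_cartesian_product card_powi_roots_unity power2_eq_square)
qed

lemma card_act_solutions_weyl:
  assumes k: "k \<ge> 2" and g: "(a, b, c, d) \<in> G2_weyl"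
  shows "card (act_solutions k (a, b, c, d)) = nat ((int k - a) * (int k - d) - b * c)"
    and "(int k - a) * (int k - d) - b * c > 0"
proof -
  \<comment> \<open>In terms of \<open>m\<close> each determinant is a quadratic with nonnegative
    coefficients and positive constant term; \<open>q\<close> makes the inequality linear.\<close>
  obtain m where m: "k = m + 2"
    using k by (metis add.commute le_Suc_ex)
  define q where "q = int m * int m"
  have "q \<ge> 0" by (simp add: q_def)
  then show pos: "(int k - a) * (int k - d) - b * c > 0"
    using g unfolding G2_weyl_def by (auto simp: m algebra_simps simp flip: q_def)
  \<comment> \<open>Only plus and minus the identity have no off-diagonal unit.\<close>
  consider "b = 1 \<or> b = - 1" | "c = 1 \<or> c = - 1" | "b = 0" "c = 0" "d = a" "a < int k"
    using g k unfolding G2_weyl_def by auto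
  then show "card (act_solutions k (a, b, c, d)) = nat ((int k - a) * (int k - d) - b * c)"
  proof cases
    case 1
    then show ?thesis
      using pos by (intro card_act_solutions) auto
  next
    case 2
    then have "card (act_solutions k (d, c, b, a)) = nat ((int k - a) * (int k - d) - b * c)"
      using pos by (intro card_act_solutions) (auto simp: mult.commute)
    then show ?thesis
      using card_act_solutions_swap by simp
  next
    case 3
    then show ?thesis
      by (simp add: card_act_solutions_scalar power2_eq_square nat_mult_distrib)
  qed
qed

text \<open>Here det (k - g) = k^2 - k tr g + det g. Traces cancel between \<open>g\<close> and its
  negative, and six determinants are 1 and six are -1, leaving only the squares.\<close>

lemma sum_card_act_solutions:
  assumes "k \<ge> 2"
  shows "(\<Sum>g\<in>G2_weyl. card (act_solutions k g)) = 12 * k ^ 2"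
proof -
  have "int (\<Sum>g\<in>G2_weyl. card (act_solutions k g)) = (\<Sum>g\<in>G2_weyl. int (card (act_solutions k g)))"
    by simp
  also have "\<dots> = (\<Sum>(a, b, c, d)\<in>G2_weyl. (int k - a) * (int k - d) - b * c)"
  proof (rule sum.cong[OF refl])
    fix g assume "g \<in> G2_weyl"
    moreover obtain a b c d where "g = (a, b, c, d)" by (cases g)
    ultimately show "int (card (act_solutions k g))
        = (case g of (a, b, c, d) \<Rightarrow> (int k - a) * (int k - d) - b * c)"
      using card_act_solutions_weyl[OF assms, of a b c d] by simp
  qed
  also have "\<dots> = int (12 * k ^ 2)"
    by (simp add: G2_weyl_def algebra_simps power2_eq_square)
  finally show ?thesis
    using of_nat_eq_iff by blast
qed

lemma finite_act_solutions:
  assumes "k \<ge> 2" "g \<in> G2_weyl"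
  shows "finite (act_solutions k g)"
proof -
  obtain a b c d where g: "g = (a, b, c, d)" by (cases g)
  \<comment> \<open>Infinite sets have \<open>card\<close> 0, so a positive value proves
    finiteness.\<close>
  have "card (act_solutions k g) > 0"
    using card_act_solutions_weyl[OF assms(1) assms(2)[unfolded g]] by (simp add: g)
  then show ?thesis
    by (rule card_ge_0_finite)
qed

section \<open>Double count of the fixed points\<close>

theorem theorem3p4:
  fixes k :: nat
  assumes "k \<ge> 2"
  shows "finite (Fix (G2_map k)) \<and> card (Fix (G2_map k)) = k ^ 2"
proof -
  define Z where "Z = (SIGMA g:G2_weyl. act_solutions k g)"
  have finite_Z: "finite Z"
    unfolding Z_def using assms by (intro finite_SigmaI finite_G2_weyl finite_act_solutions)
  have card_Z: "card Z = 12 * k ^ 2"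
    unfolding Z_def using sum_card_act_solutions[OF assms] finite_act_solutions[OF assms] finite_G2_weyl
    by simp
  have Fix_eq: "Fix (G2_map k) = (G2_quot \<circ> snd) ` Z"
  proof (intro equalityI subsetI)
    fix \<alpha> assume \<alpha>: "\<alpha> \<in> Fix (G2_map k)"
    obtain z where z: "z \<in> torus" "G2_quot z = \<alpha>"
      using G2_quot_surj by blast
    have "G2_quot z = G2_quot (torus_pow k z)"
      using \<alpha> G2_map_quot[OF z(1), of k] by (simp add: Fix_def z(2))
    then obtain g where "g \<in> G2_weyl" "torus_act g z = torus_pow k z"
      using G2_quot_eq_imp_act z(1) torus_pow_closed by blast
    then have "(g, z) \<in> Z"
      using z(1) by (simp add: Z_def act_solutions_def)
    then show "\<alpha> \<in> (G2_quot \<circ> snd) ` Z"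
      using z(2) by force
  next
    fix \<alpha> assume "\<alpha> \<in> (G2_quot \<circ> snd) ` Z"
    then obtain g z where "g \<in> G2_weyl" "z \<in> torus" "torus_pow k z = torus_act g z" "\<alpha> = G2_quot z"
      by (auto simp: Z_def act_solutions_def)
    then show "\<alpha> \<in> Fix (G2_map k)"
      by (simp add: Fix_def G2_map_quot G2_quot_act)
  qed
  have fibre: "card {p \<in> Z. (G2_quot \<circ> snd) p = \<alpha>} = 12" if \<alpha>: "\<alpha> \<in> Fix (G2_map k)" for \<alpha>
  proof -
    \<comment> \<open>\<open>X\<close> is a single Weyl orbit, and \<open>torus_pow k\<close> maps
      it to itself because \<alpha> is fixed, so the count for transitive actions applies.\<close>
    define X where "X = {z \<in> torus. G2_quot z = \<alpha>}"
    obtain z0 where "z0 \<in> X"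
      using G2_quot_surj unfolding X_def by blast
    have "card {(g, z). g \<in> G2_weyl \<and> z \<in> X \<and> torus_pow k z = torus_act g z} = card G2_weyl"
    proof (rule card_transitive_act_eq_self_map[OF finite_G2_weyl \<open>z0 \<in> X\<close> mat2_mult_closed inj_mat2_mult])
      show "torus_act (mat2_mult g h) z = torus_act g (torus_act h z)" if "z \<in> X" for g h z
        using that by (simp add: X_def torus_act_mult)
      show "torus_act g z \<in> X" if "g \<in> G2_weyl" "z \<in> X" for g z
        using that by (simp add: X_def torus_act_closed G2_quot_act)
      show "\<exists>g\<in>G2_weyl. torus_act g z = z'" if "z \<in> X" "z' \<in> X" for z z'
        using that by (intro G2_quot_eq_imp_act) (simp_all add: X_def)
      show "torus_pow k z \<in> X" if "z \<in> X" for z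
        using that \<alpha> G2_map_quot[of z k] by (simp add: X_def torus_pow_closed Fix_def)
    qed
    moreover have "{p \<in> Z. (G2_quot \<circ> snd) p = \<alpha>}
        = {(g, z). g \<in> G2_weyl \<and> z \<in> X \<and> torus_pow k z = torus_act g z}"
      by (auto simp: Z_def X_def act_solutions_def)
    ultimately show ?thesis
      by (simp add: card_G2_weyl)
  qed
  have finite_Fix: "finite (Fix (G2_map k))"
    unfolding Fix_eq using finite_Z by (rule finite_imageI)
  have "12 * k ^ 2 = (\<Sum>p\<in>Z. 1)"
    using card_Z by simp
  \<comment> \<open>The pairs in \<open>Z\<close> are sorted by the fixed point that they lie
    over.\<close>
  also have "\<dots> = (\<Sum>\<alpha>\<in>Fix (G2_map k). \<Sum>p\<in>{p \<in> Z. (G2_quot \<circ> snd) p = \<alpha>}. 1)"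
    by (rule sum.group[symmetric]) (use finite_Z finite_Fix Fix_eq in auto)
  also have "\<dots> = (\<Sum>\<alpha>\<in>Fix (G2_map k). 12)"
    by (rule sum.cong[OF refl]) (simp only: fibre flip: card_eq_sum)
  also have "\<dots> = 12 * card (Fix (G2_map k))"
    by simp
  finally show ?thesis
    using finite_Fix by simp
qed

end
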